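(* Let $X$ be a complete matching, let $k\ne\ell$ be firms, let $j\in X_k$, and let $X'$ be obtained from $X$ by moving the single worker $j$ from firm $k$ to firm $\ell$. Write $v_k=a_{kj}$ and $v_\ell=a_{\ell j}$. Then for any fixed $z\ge 0$, $$D_i(X',z)=D_i(X,z)\ \ (i\notin\{k,\ell\}),\qquad D_k(X',z)=D_k(X,z)-z_j,\qquad D_\ell(X',z)=D_\ell(X,z)+z_j .$$ Hence $$R_i(X',z)=R_i(X,z)\ \ (i\notin\{k,\ell\}),\qquad R_k(X',z)=\frac{D_k(X,z)-z_j}{B_k-v_k},\qquad R_\ell(X',z)=\frac{D_\ell(X,z)+z_j}{B_\ell+v_\ell}.$$ Moreover, $$\Phi(X')=\min_{z\ge 0}\max\left\{\max_{i\notin\{k,\ell\}}R_i(X,z),\ \frac{D_k(X,z)-z_j}{B_k-v_k},\ \frac{D_\ell(X,z)+z_j}{B_\ell+v_\ell}\right\}.$$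
   Context: Market: $F=\{1,\dots,m\}$ is the set of firms, $W$ the finite set of workers; firm $i$ values worker $h$ at $a_{ih}\ge 0$, additively: $V_i(T)=\sum_{h\in T}a_{ih}$. A complete matching $X=(X_1,\dots,X_m)$ is a partition of $W$ (parts may be empty), $X_i$ being the workers of firm $i$; $B_i=V_i(X_i)$ denotes the output of firm $i$ under $X$. For a matching $Y$ and $z=(z_h)_{h\in W}\ge 0$, with $[u]_+=\max\{u,0\}$, let $D_i(Y,z)=\sum_{h\in Y_i}z_h+\sum_{h\in W}[a_{ih}-z_h]_+$, and let $R_i(Y,z)=D_i(Y,z)/V_i(Y_i)$ if $V_i(Y_i)>0$, $R_i(Y,z)=+\infty$ if $V_i(Y_i)=0<D_i(Y,z)$, and $R_i(Y,z)=0$ if $V_i(Y_i)=D_i(Y,z)=0$. Displayed fractions with zero denominator are read by the same convention ($c/0=+\infty$ for $c>0$, $0/0=0$). $\Phi(Y)=\min_{z\ge 0}\max_{i\in F}R_i(Y,z)$. If $m=2$, the maximum over $i\notin\{k,\ell\}$ is omitted. *)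

theory Defs
  imports "HOL-Analysis.Analysis"
begin

text \<open>Firms are the indices in \<open>{1..m}\<close>, workers form a finite set \<open>W\<close>, and \<open>a i h\<close> is the value
  of worker \<open>h\<close> to firm \<open>i\<close>. A matching is given by its family of parts \<open>X i\<close>; values outside
  \<open>{1..m}\<close> (of \<open>X\<close>) and outside \<open>W\<close> (of price vectors) are irrelevant.\<close>

definition firm_value :: "(nat \<Rightarrow> 'w \<Rightarrow> real) \<Rightarrow> nat \<Rightarrow> 'w set \<Rightarrow> real" where
  "firm_value a i T = (\<Sum>h\<in>T. a i h)"

definition complete_matching :: "nat \<Rightarrow> 'w set \<Rightarrow> (nat \<Rightarrow> 'w set) \<Rightarrow> bool" where
  "complete_matching m W X \<longleftrightarrow> (\<Union>i\<in>{1..m}. X i) = W \<and> disjoint_family_on X {1..m}"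

definition nonneg_prices :: "'w set \<Rightarrow> ('w \<Rightarrow> real) set" where
  "nonneg_prices W = {z. \<forall>h\<in>W. 0 \<le> z h}"

definition D_val ::
  "'w set \<Rightarrow> (nat \<Rightarrow> 'w \<Rightarrow> real) \<Rightarrow> nat \<Rightarrow> (nat \<Rightarrow> 'w set) \<Rightarrow> ('w \<Rightarrow> real) \<Rightarrow> real" where
  "D_val W a i Y z = (\<Sum>h\<in>Y i. z h) + (\<Sum>h\<in>W. max (a i h - z h) 0)"

text \<open>Division of nonnegative reals with \<open>c/0 = \<infinity>\<close> for \<open>c > 0\<close> and \<open>0/0 = 0\<close>.\<close>

definition quot :: "real \<Rightarrow> real \<Rightarrow> ereal" where
  "quot c d = (if d = 0 then (if c > 0 then \<infinity> else 0) else ereal (c / d))"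

definition R_val ::
  "'w set \<Rightarrow> (nat \<Rightarrow> 'w \<Rightarrow> real) \<Rightarrow> nat \<Rightarrow> (nat \<Rightarrow> 'w set) \<Rightarrow> ('w \<Rightarrow> real) \<Rightarrow> ereal" where
  "R_val W a i Y z = quot (D_val W a i Y z) (firm_value a i (Y i))"

text \<open>A minimum has to be attained, unlike an infimum.\<close>

definition is_min_over :: "('b \<Rightarrow> 'a::order) \<Rightarrow> 'b set \<Rightarrow> 'a \<Rightarrow> bool" where
  "is_min_over f S r \<longleftrightarrow> r \<in> f ` S \<and> (\<forall>x\<in>S. r \<le> f x)"

definition Phi ::
  "nat \<Rightarrow> 'w set \<Rightarrow> (nat \<Rightarrow> 'w \<Rightarrow> real) \<Rightarrow> (nat \<Rightarrow> 'w set) \<Rightarrow> ereal" where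
  "Phi m W a Y =
     (THE r. is_min_over (\<lambda>z. Max ((\<lambda>i. R_val W a i Y z) ` {1..m})) (nonneg_prices W) r)"

end

theory Submission
  imports Defs
begin

lemma is_min_over_unique:
  assumes "is_min_over f S r" "is_min_over f S s"
  shows "r = s"
  using assms unfolding is_min_over_def by (auto intro: order.antisym)

text \<open>Minima are unique, so a single attained minimum already makes the definite description
  in \<open>Phi\<close> denote it.\<close>

lemma is_min_over_The:
  assumes "is_min_over f S r"
  shows "is_min_over f S (THE r. is_min_over f S r)"
  using assms by (rule theI) (rule is_min_over_unique[OF _ assms])

lemma quot_mono:
  assumes "c \<le> c'" "0 \<le> d"
  shows "quot c d \<le> quot c' d"
  using assms by (auto simp: quot_def divide_right_mono)

lemma firm_value_nonneg:
  assumes "\<And>h. h \<in> T \<Longrightarrow> 0 \<le> a i h"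
  shows "0 \<le> firm_value a i T"
  unfolding firm_value_def using assms by (rule sum_nonneg)

lemma continuous_on_Max_image:
  fixes f :: "'i \<Rightarrow> 'a::topological_space \<Rightarrow> 'b::linorder_topology"
  assumes "finite I" "I \<noteq> {}" "\<And>i. i \<in> I \<Longrightarrow> continuous_on S (f i)"
  shows "continuous_on S (\<lambda>x. Max ((\<lambda>i. f i x) ` I))"
  using assms
proof (induction rule: finite_ne_induct)
  case (insert i I)
  then have "continuous_on S (\<lambda>x. max (f i x) (Max ((\<lambda>i. f i x) ` I)))"
    by (intro continuous_on_max) auto
  with insert.hyps show ?case by simp
qed simp

lemma continuous_on_D_val: "continuous_on S (D_val W a i Y)"
  unfolding D_val_def
  by (intro continuous_intros continuous_on_subset[OF continuous_on_product_coordinates]) auto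

text \<open>Price vectors are functions on the whole type, so the irrelevant coordinates outside
  \<open>W\<close> are pinned to 0; otherwise they would be unbounded and no compact box could
  contain the truncated vectors.\<close>

definition truncate_prices :: "'w set \<Rightarrow> real \<Rightarrow> ('w \<Rightarrow> real) \<Rightarrow> 'w \<Rightarrow> real" where
  "truncate_prices W M z = (\<lambda>h. if h \<in> W then min (z h) M else 0)"

text \<open>Lowering a price from above \<open>M\<close> to \<open>M\<close> keeps the positive part
  at 0, because \<open>M\<close> bounds the values, and it can only shrink the sum of prices over
  \<open>Y i\<close>.\<close>

lemma D_val_truncate_le:
  assumes "Y i \<subseteq> W" "\<And>h. h \<in> W \<Longrightarrow> a i h \<le> M"
  shows "D_val W a i Y (truncate_prices W M z) \<le> D_val W a i Y z"
  unfolding D_val_def truncate_prices_def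
proof (intro add_mono sum_mono)
  fix h assume "h \<in> W"
  then show "max (a i h - (if h \<in> W then min (z h) M else 0)) 0 \<le> max (a i h - z h) 0"
    using assms(2)[of h] by auto
qed (use assms(1) in auto)

text \<open>Tychonoff: every factor is a closed interval or a singleton, and the topology on
  functions is the product topology.\<close>

lemma compact_price_box:
  "compact {z. \<forall>h. z h \<in> (if h \<in> W then {0..M::real} else {0})}"
proof -
  have "compactin (product_topology (\<lambda>_. euclidean) UNIV)
      (PiE UNIV (\<lambda>h. if h \<in> W then {0..M} else {0}))"
    unfolding compactin_PiE by auto
  then have "compact (PiE UNIV (\<lambda>h. if h \<in> W then {0..M} else {0}))"
    by (metis euclidean_product_topology compactin_euclidean_iff)
  then show ?thesis by (simp add: PiE_def Pi_def)
qed

text \<open>Truncating prices at the largest value does not increase any \<open>D_val\<close>, so only a compact box of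
  prices matters. The ratios are merely lower semicontinuous where \<open>firm_value\<close> vanishes; they become
  continuous on the closed set where \<open>D_val\<close> of these firms vanishes, and off this set the
  maximum is \<open>\<infinity>\<close>.\<close>

lemma Max_R_val_attains_min:
  fixes a :: "nat \<Rightarrow> 'w \<Rightarrow> real"
  assumes "finite W" and a: "\<And>i h. i \<in> I \<Longrightarrow> h \<in> W \<Longrightarrow> 0 \<le> a i h"
    and I: "finite I" "I \<noteq> {}" and Y: "\<And>i. i \<in> I \<Longrightarrow> Y i \<subseteq> W"
  shows "\<exists>r. is_min_over (\<lambda>z. Max ((\<lambda>i. R_val W a i Y z) ` I)) (nonneg_prices W) r"
proof -
  define f where "f z = Max ((\<lambda>i. R_val W a i Y z) ` I)" for z
  \<comment> \<open>Inserting 0 keeps the maximum well defined when \<open>W\<close> is empty and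
    gives \<open>0 \<le> M\<close> directly.\<close>
  define M where "M = Max (insert 0 ((\<lambda>(i, h). a i h) ` (I \<times> W)))"
  define K where "K = {z. \<forall>h. z h \<in> (if h \<in> W then {0..M} else {0})}"
  define Z where "Z = {i \<in> I. firm_value a i (Y i) = 0}"
  \<comment> \<open>At denominator 0, \<open>quot\<close> only asks whether the numerator is
    positive. The weak inequality is thus exactly the case of ratio 0, and it is a closed
    condition.\<close>
  define K0 where "K0 = K \<inter> {z. \<forall>i\<in>Z. D_val W a i Y z \<le> 0}"
  have M: "a i h \<le> M" if "i \<in> I" "h \<in> W" for i h
    unfolding M_def using that assms(1) I by (intro Max_ge) force+
  have "0 \<le> M"
    unfolding M_def using assms(1) I by (intro Max_ge) auto
  have K_sub: "K \<subseteq> nonneg_prices W"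
  proof
    fix z assume "z \<in> K"
    then have "z h \<in> (if h \<in> W then {0..M} else {0})" for h by (simp add: K_def)
    then have "0 \<le> z h" if "h \<in> W" for h using that by (metis atLeastAtMost_iff)
    then show "z \<in> nonneg_prices W" by (simp add: nonneg_prices_def)
  qed
  have trunc_K: "truncate_prices W M z \<in> K" if "z \<in> nonneg_prices W" for z
    using that \<open>0 \<le> M\<close> by (auto simp: K_def truncate_prices_def nonneg_prices_def)
  \<comment> \<open>The denominators do not depend on prices, so the bound on \<open>D_val\<close>
    passes to each ratio and then to the maximum.\<close>
  have trunc_le: "f (truncate_prices W M z) \<le> f z" for z
    unfolding f_def
  proof (intro Max.boundedI)
    fix r assume "r \<in> (\<lambda>i. R_val W a i Y (truncate_prices W M z)) ` I"
    then obtain i where i: "i \<in> I" "r = R_val W a i Y (truncate_prices W M z)" by auto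
    have "0 \<le> firm_value a i (Y i)"
      using i(1) a Y by (intro firm_value_nonneg) blast
    then have "r \<le> R_val W a i Y z"
      unfolding i(2) R_val_def
      by (intro quot_mono D_val_truncate_le) (use Y[OF i(1)] M[OF i(1)] in auto)
    also have "\<dots> \<le> Max ((\<lambda>i. R_val W a i Y z) ` I)"
      using i(1) I by (intro Max_ge) auto
    finally show "r \<le> \<dots>" .
  qed (use I in auto)
  have off_K0: "f z = \<infinity>" if z: "z \<in> K - K0" for z
  proof -
    obtain i where "i \<in> Z" "D_val W a i Y z > 0"
      using z by (auto simp: K0_def not_le)
    then have "R_val W a i Y z = \<infinity>" "i \<in> I"
      by (auto simp: R_val_def quot_def Z_def)
    then have "\<infinity> \<le> f z"
      unfolding f_def using I by (metis Max_ge finite_imageI imageI)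
    then show ?thesis by simp
  qed
  have "\<exists>x\<in>K. \<forall>y\<in>K. f x \<le> f y"
  proof (cases "K0 = {}")
    \<comment> \<open>Here \<open>f\<close> is constantly \<open>\<infinity>\<close> on
      \<open>K\<close>, so any point of \<open>K\<close> is a minimiser; the truncated zero vector
      provides one.\<close>
    case True
    moreover have "truncate_prices W M (\<lambda>_. 0) \<in> K"
      by (rule trunc_K) (simp add: nonneg_prices_def)
    ultimately show ?thesis using off_K0 by (metis Diff_empty order_refl)
  next
    case False
    have "closed {z. \<forall>i\<in>Z. D_val W a i Y z \<le> 0}"
      unfolding Collect_ball_eq
      by (intro closed_INT ballI closed_Collect_le continuous_on_D_val continuous_on_const)
    then have "compact K0"
      unfolding K0_def K_def by (intro compact_Int_closed compact_price_box)
    moreover have "continuous_on K0 f"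
      unfolding f_def
    proof (intro continuous_on_Max_image I)
      fix i assume "i \<in> I"
      show "continuous_on K0 (R_val W a i Y)"
      proof (cases "i \<in> Z")
        case True
        then have "R_val W a i Y z = 0" if "z \<in> K0" for z
          using that by (auto simp: K0_def R_val_def quot_def Z_def)
        then show ?thesis by (simp cong: continuous_on_cong)
      next
        case False
        with \<open>i \<in> I\<close> have "firm_value a i (Y i) \<noteq> 0" by (simp add: Z_def)
        then show ?thesis
          unfolding R_val_def quot_def
          by (auto intro!: continuous_intros continuous_on_D_val)
      qed
    qed
    ultimately obtain x where "x \<in> K0" "\<And>y. y \<in> K0 \<Longrightarrow> f x \<le> f y"
      using continuous_attains_inf[OF _ False] by blast
    moreover have "K0 \<subseteq> K" by (simp add: K0_def)
    \<comment> \<open>A minimiser over \<open>K0\<close> also wins against the rest of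
      \<open>K\<close>, where \<open>f\<close> is \<open>\<infinity>\<close>.\<close>
    ultimately show ?thesis using off_K0
      by (metis DiffI ereal_less_eq(1) subsetD)
  qed
  then obtain x where "x \<in> K" and x: "\<And>y. y \<in> K \<Longrightarrow> f x \<le> f y" by blast
  have "is_min_over f (nonneg_prices W) (f x)"
    unfolding is_min_over_def
    using \<open>x \<in> K\<close> K_sub x[OF trunc_K] trunc_le by (blast intro: order_trans)
  then show ?thesis unfolding f_def by blast
qed

theorem theorem2:
  fixes m :: nat and W :: "'w set" and a :: "nat \<Rightarrow> 'w \<Rightarrow> real"
    and X X' :: "nat \<Rightarrow> 'w set" and k l :: nat and j :: 'w
  assumes "finite W"
    and "\<And>i h. i \<in> {1..m} \<Longrightarrow> h \<in> W \<Longrightarrow> 0 \<le> a i h"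
    and "complete_matching m W X"
    and "k \<in> {1..m}" and "l \<in> {1..m}" and "k \<noteq> l" and "j \<in> X k"
    and "X' = X(k := X k - {j}, l := X l \<union> {j})"
  shows "(\<forall>z\<in>nonneg_prices W.
            (\<forall>i\<in>{1..m} - {k, l}. D_val W a i X' z = D_val W a i X z)
          \<and> D_val W a k X' z = D_val W a k X z - z j
          \<and> D_val W a l X' z = D_val W a l X z + z j
          \<and> (\<forall>i\<in>{1..m} - {k, l}. R_val W a i X' z = R_val W a i X z)
          \<and> R_val W a k X' z = quot (D_val W a k X z - z j) (firm_value a k (X k) - a k j)
          \<and> R_val W a l X' z = quot (D_val W a l X z + z j) (firm_value a l (X l) + a l j))
       \<and> is_min_over
           (\<lambda>z. Max ((\<lambda>i. R_val W a i X z) ` ({1..m} - {k, l})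
                   \<union> {quot (D_val W a k X z - z j) (firm_value a k (X k) - a k j),
                      quot (D_val W a l X z + z j) (firm_value a l (X l) + a l j)}))
           (nonneg_prices W) (Phi m W a X')"
proof -
  have sub: "X i \<subseteq> W" if "i \<in> {1..m}" for i
    using assms(3) that by (auto simp: complete_matching_def)
  have fin: "finite (X i)" if "i \<in> {1..m}" for i
    using sub[OF that] assms(1) by (rule finite_subset)
  \<comment> \<open>By disjointness of \<open>X k\<close> and \<open>X l\<close>, adding
    \<open>j\<close> to \<open>X l\<close> contributes exactly one new summand.\<close>
  have "j \<notin> X l"
    using assms(3-7) unfolding complete_matching_def disjoint_family_on_def by blast
  have "j \<in> W" using sub assms(4,7) by blast
  have parts: "X' k = X k - {j}" "X' l = insert j (X l)" "\<And>i. i \<notin> {k, l} \<Longrightarrow> X' i = X i"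
    using assms(6,8) by auto
  have D: "D_val W a i X' z = D_val W a i X z"
    and R: "R_val W a i X' z = R_val W a i X z" if "i \<notin> {k, l}" for i z
    using parts(3)[OF that] by (simp_all add: D_val_def R_val_def)
  \<comment> \<open>The sum of positive parts over \<open>W\<close> does not involve the matching,
    so only the sum of prices over the firm's own workers changes.\<close>
  have Dk: "D_val W a k X' z = D_val W a k X z - z j" for z
    using fin[OF assms(4)] assms(7) by (simp add: D_val_def parts(1) sum_diff1)
  have Dl: "D_val W a l X' z = D_val W a l X z + z j" for z
    using fin[OF assms(5)] \<open>j \<notin> X l\<close> by (simp add: D_val_def parts(2))
  have Rk: "R_val W a k X' z = quot (D_val W a k X z - z j) (firm_value a k (X k) - a k j)" for z
    using fin[OF assms(4)] assms(7)
    by (simp add: R_val_def Dk) (simp add: parts(1) firm_value_def sum_diff1)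
  have Rl: "R_val W a l X' z = quot (D_val W a l X z + z j) (firm_value a l (X l) + a l j)" for z
    using fin[OF assms(5)] \<open>j \<notin> X l\<close>
    by (simp add: R_val_def Dl) (simp add: parts(2) firm_value_def add.commute)
  have "X' i \<subseteq> W" if "i \<in> {1..m}" for i
    using sub[OF that] \<open>j \<in> W\<close> assms(8) by auto
  \<comment> \<open>Attainment for \<open>X'\<close> has to come first: only then is
    \<open>Phi m W a X'\<close> known to be a minimum.\<close>
  then have "\<exists>r. is_min_over (\<lambda>z. Max ((\<lambda>i. R_val W a i X' z) ` {1..m})) (nonneg_prices W) r"
    using assms(1,2,4) by (intro Max_R_val_attains_min) auto
  then have min: "is_min_over (\<lambda>z. Max ((\<lambda>i. R_val W a i X' z) ` {1..m})) (nonneg_prices W)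
      (Phi m W a X')"
    unfolding Phi_def by (blast intro: is_min_over_The)
  \<comment> \<open>Equal sets of ratios at every \<open>z\<close> make the two objectives the same
    function. For \<open>m = 2\<close> the first image is empty and the two ratios of
    \<open>k\<close> and \<open>l\<close> remain, as the convention demands.\<close>
  have "(\<lambda>i. R_val W a i X' z) ` {1..m} = (\<lambda>i. R_val W a i X z) ` ({1..m} - {k, l})
      \<union> {R_val W a k X' z, R_val W a l X' z}" for z
  proof -
    have "(\<lambda>i. R_val W a i X' z) ` {1..m} = (\<lambda>i. R_val W a i X' z) ` ({1..m} - {k, l})
        \<union> {R_val W a k X' z, R_val W a l X' z}"
      using assms(4,5) by auto
    also have "(\<lambda>i. R_val W a i X' z) ` ({1..m} - {k, l}) = (\<lambda>i. R_val W a i X z) ` ({1..m} - {k, l})"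
      by (intro image_cong refl R) auto
    finally show ?thesis .
  qed
  with min D Dk Dl R Rk Rl show ?thesis by simp
qed

end
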